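(* Let $k\ge 1$ and $h_1,\dots,h_k>0$, and let $\mathbf{H}\in\mathbb{R}^{k\times k}$ be the matrix of the finite volume discretization of the heat equation with homogeneous Neumann boundary conditions on $k$ cells of lengths $h_1,\dots,h_k$. Then $\mathbf{H}$ is a conservative and positive filter generator (with respect to $h_1,\dots,h_k$).
   Context: The numbers $h_1,\dots,h_k>0$ are the lengths of the $k$ control volumes (consecutive subintervals) into which a spectral volume (an interval) is subdivided. Definition of $\mathbf{H}$: for $\mathbf{u}=(u_1,\dots,u_k)^T\in\mathbb{R}^k$ define the discrete heat fluxes $$f^{h}_{0+1/2} = f^{h}_{k+1/2} = 0, \qquad f^{h}_{j+1/2} = -2\cdot\frac{u_{j+1}-u_j}{h_{j+1}+h_j}, \quad j=1,\dots,k-1.$$ The semidiscrete heat equation is $$\frac{d u_j}{dt} = \frac{f^{h}_{j-1/2}-f^{h}_{j+1/2}}{h_j}, \quad j=1,\dots,k.$$ The right-hand side is linear in $\mathbf{u}$, and $\mathbf{H}\in\mathbb{R}^{k\times k}$ is the matrix such that this system reads $\frac{d\mathbf{u}}{dt}=\mathbf{H}\mathbf{u}$, i.e. $(\mathbf{H}\mathbf{u})_j = (f^{h}_{j-1/2}-f^{h}_{j+1/2})/h_j$ for all $\mathbf{u}\in\mathbb{R}^k$ and $j=1,\dots,k$. Filter generators: a matrix $G\in\mathbb{R}^{k\times k}$ is called a filter generator if $\sum_{l=1}^{k} G_{jl}=0$ for all $j\in\{1,\dots,k\}$. It is called conservative if $\sum_{j=1}^{k} h_j G_{jl}=0$ for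 all $l\in\{1,\dots,k\}$. It is called positive if $G_{jl}\ge 0$ for all $l\in\{1,\dots,k\}$ and all $j\in\{1,\dots,l-1,l+1,\dots,k\}$ (i.e. all off-diagonal entries are non-negative). *)

theory Defs
  imports Complex_Main "Jordan_Normal_Form.Matrix"
begin

text \<open>
  Cells are numbered from 0, following the indexing of vectors and matrices: cell \<open>j < k\<close> has
  length \<open>h j\<close> and lies between the interfaces \<open>j\<close> and \<open>j + 1\<close>.  Interface \<open>i \<le> k\<close> is thus the
  one usually written \<open>i + 1/2\<close> when the cells are numbered from 1, and the interfaces \<open>0\<close> and
  \<open>k\<close> are the two ends of the spectral volume, where the Neumann condition makes the flux vanish.
  Values of \<open>h\<close> outside \<open>{0..<k}\<close> are never used.
\<close>

definition heat_flux :: "nat \<Rightarrow> (nat \<Rightarrow> real) \<Rightarrow> real vec \<Rightarrow> nat \<Rightarrow> real" where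
  "heat_flux k h u i =
     (if i = 0 \<or> i = k then 0 else - 2 * ((u $ i - u $ (i - 1)) / (h i + h (i - 1))))"

definition heat_rhs :: "nat \<Rightarrow> (nat \<Rightarrow> real) \<Rightarrow> real vec \<Rightarrow> real vec" where
  "heat_rhs k h u = vec k (\<lambda>j. (heat_flux k h u j - heat_flux k h u (j + 1)) / h j)"

definition heat_matrix :: "nat \<Rightarrow> (nat \<Rightarrow> real) \<Rightarrow> real mat" where
  "heat_matrix k h =
     (THE H. H \<in> carrier_mat k k \<and> (\<forall>u \<in> carrier_vec k. H *\<^sub>v u = heat_rhs k h u))"

text \<open>The description is proper for every \<open>h\<close>, because the right-hand side is linear in \<open>u\<close>.\<close>

lemma heat_flux_unit_vec_sum:
  assumes u: "u \<in> carrier_vec k" and i: "i \<le> k"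
  shows "heat_flux k h u i = (\<Sum>l<k. heat_flux k h (unit_vec k l) i * u $ l)"
proof (cases "i = 0 \<or> i = k")
  case True
  then show ?thesis by (auto simp: heat_flux_def)
next
  case False
  have pick: "(\<Sum>l<k. unit_vec k l $ m * u $ l) = u $ m" if "m < k" for m
  proof -
    have "(\<Sum>l<k. unit_vec k l $ m * u $ l) = (\<Sum>l<k. if l = m then u $ l else 0)"
      using that by (intro sum.cong) auto
    then show ?thesis using that by simp
  qed
  have "(\<Sum>l<k. heat_flux k h (unit_vec k l) i * u $ l)
      = (\<Sum>l<k. (- 2 / (h i + h (i - 1))) * (unit_vec k l $ i * u $ l)
                - (- 2 / (h i + h (i - 1))) * (unit_vec k l $ (i - 1) * u $ l))"
    using False by (intro sum.cong) (auto simp: heat_flux_def algebra_simps diff_divide_distrib)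
  also have "\<dots> = (- 2 / (h i + h (i - 1))) * u $ i - (- 2 / (h i + h (i - 1))) * u $ (i - 1)"
  proof -
    from False i have "i < k" "i - 1 < k" by auto
    then show ?thesis
      by (simp only: sum_subtractf sum_distrib_left[symmetric] pick)
  qed
  finally show ?thesis
    using False by (simp add: heat_flux_def algebra_simps diff_divide_distrib)
qed

lemma heat_matrix_ex1:
  "\<exists>!H. H \<in> carrier_mat k k \<and> (\<forall>u \<in> carrier_vec k. H *\<^sub>v u = heat_rhs k h u)"
proof (rule ex1I)
  let ?H = "mat k k (\<lambda>(j, l). heat_rhs k h (unit_vec k l) $ j)"
  have "?H *\<^sub>v u = heat_rhs k h u" if u: "u \<in> carrier_vec k" for u
  proof (rule eq_vecI)
    show "dim_vec (?H *\<^sub>v u) = dim_vec (heat_rhs k h u)" by (simp add: heat_rhs_def)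
    fix j assume "j < dim_vec (heat_rhs k h u)"
    then have j: "j < k" by (simp add: heat_rhs_def)
    have "(?H *\<^sub>v u) $ j = (\<Sum>l<k. heat_rhs k h (unit_vec k l) $ j * u $ l)"
      using j u by (auto simp: scalar_prod_def lessThan_atLeast0 intro!: sum.cong)
    also have "\<dots> = (\<Sum>l<k. (heat_flux k h (unit_vec k l) j * u $ l
                      - heat_flux k h (unit_vec k l) (j + 1) * u $ l) / h j)"
      using j by (intro sum.cong) (auto simp: heat_rhs_def algebra_simps)
    also have "\<dots> = heat_rhs k h u $ j"
      using j by (simp add: heat_rhs_def heat_flux_unit_vec_sum[OF u, of j]
          heat_flux_unit_vec_sum[OF u, of "Suc j"] sum_subtractf flip: sum_divide_distrib)
    finally show "(?H *\<^sub>v u) $ j = heat_rhs k h u $ j" .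
  qed
  then show "?H \<in> carrier_mat k k \<and> (\<forall>u \<in> carrier_vec k. ?H *\<^sub>v u = heat_rhs k h u)"
    by simp
next
  fix H assume H: "H \<in> carrier_mat k k \<and> (\<forall>u \<in> carrier_vec k. H *\<^sub>v u = heat_rhs k h u)"
  show "H = mat k k (\<lambda>(j, l). heat_rhs k h (unit_vec k l) $ j)"
  proof (rule eq_matI)
    fix j l
    assume "j < dim_row (mat k k (\<lambda>(j, l). heat_rhs k h (unit_vec k l) $ j))"
      and "l < dim_col (mat k k (\<lambda>(j, l). heat_rhs k h (unit_vec k l) $ j))"
    then have jl: "j < k" "l < k" by auto
    have "heat_rhs k h (unit_vec k l) $ j = (H *\<^sub>v unit_vec k l) $ j"
      using H by simp
    also have "\<dots> = H $$ (j, l)"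
      using conjunct1[OF H] jl by (simp add: scalar_prod_right_unit[of _ k])
    finally show "H $$ (j, l) = mat k k (\<lambda>(j, l). heat_rhs k h (unit_vec k l) $ j) $$ (j, l)"
      using jl by simp
  qed (use H in auto)
qed

lemma heat_matrix_carrier: "heat_matrix k h \<in> carrier_mat k k"
  and heat_matrix_mult_vec: "u \<in> carrier_vec k \<Longrightarrow> heat_matrix k h *\<^sub>v u = heat_rhs k h u"
  using theI'[OF heat_matrix_ex1[of k h]] by (auto simp: heat_matrix_def)

definition filter_generator :: "nat \<Rightarrow> real mat \<Rightarrow> bool" where
  "filter_generator k G \<longleftrightarrow> G \<in> carrier_mat k k \<and> (\<forall>j<k. (\<Sum>l<k. G $$ (j, l)) = 0)"

definition conservative :: "nat \<Rightarrow> (nat \<Rightarrow> real) \<Rightarrow> real mat \<Rightarrow> bool" where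
  "conservative k h G \<longleftrightarrow> (\<forall>l<k. (\<Sum>j<k. h j * G $$ (j, l)) = 0)"

definition positive :: "nat \<Rightarrow> real mat \<Rightarrow> bool" where
  "positive k G \<longleftrightarrow> (\<forall>l<k. \<forall>j<k. j \<noteq> l \<longrightarrow> G $$ (j, l) \<ge> 0)"

end

theory Submission
  imports Defs
begin

text \<open>
  Each property of the matrix is a property of the heat equation, tested on particular data.  A
  constant state has no fluxes, so it is an equilibrium; the row sums of \<open>H\<close> are the
  right-hand side for the state constantly one, hence they vanish.  Heat only moves between cells,
  and none passes the two ends, so the total heat \<open>\<Sum>j<k. h j * u $ j\<close> is invariant; applied
  to the unit vectors, whose right-hand sides are the columns of \<open>H\<close>, this is conservativity.
  Finally heat flows from warm to cold, so a coldest cell never gets colder; in the state given by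
  the \<open>l\<close>-th unit vector every cell other than \<open>l\<close> is a coldest one, and so the off-diagonal
  entries of column \<open>l\<close> are nonnegative.
\<close>

lemma heat_matrix_entry:
  assumes "j < k" "l < k"
  shows "heat_matrix k h $$ (j, l) = heat_rhs k h (unit_vec k l) $ j"
proof -
  have "heat_rhs k h (unit_vec k l) $ j = (heat_matrix k h *\<^sub>v unit_vec k l) $ j"
    by (simp add: heat_matrix_mult_vec)
  also have "\<dots> = heat_matrix k h $$ (j, l)"
    using heat_matrix_carrier[of k h] assms by (simp add: scalar_prod_right_unit[of _ k])
  finally show ?thesis by simp
qed

lemma heat_rhs_const:
  assumes "j < k"
  shows "heat_rhs k h (vec k (\<lambda>_. c)) $ j = 0"
  using assms by (simp add: heat_rhs_def heat_flux_def)

text \<open>The sum telescopes to the difference of the two boundary fluxes, both of which are zero.\<close>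

lemma heat_rhs_total_heat:
  assumes "\<And>j. j < k \<Longrightarrow> h j \<noteq> 0"
  shows "(\<Sum>j<k. h j * heat_rhs k h u $ j) = 0"
proof -
  have "(\<Sum>j<k. h j * heat_rhs k h u $ j)
      = (\<Sum>j<k. heat_flux k h u j - heat_flux k h u (Suc j))"
    using assms by (intro sum.cong) (auto simp: heat_rhs_def)
  also have "\<dots> = heat_flux k h u 0 - heat_flux k h u k"
    by (rule sum_lessThan_telescope')
  finally show ?thesis by (simp add: heat_flux_def)
qed

text \<open>
  The minimum principle: heat flows down the temperature gradient, so through neither interface
  does a coldest cell lose heat.
\<close>

lemma heat_rhs_nonneg_at_min:
  assumes h: "\<And>i. i < k \<Longrightarrow> h i > 0"
    and j: "j < k"
    and min: "\<And>i. i < k \<Longrightarrow> u $ j \<le> u $ i"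
  shows "heat_rhs k h u $ j \<ge> 0"
proof -
  have "heat_flux k h u j \<ge> 0"
  proof (cases "j = 0")
    case False
    have "j - 1 < k"
      using j by simp
    then have "u $ j \<le> u $ (j - 1)" "h j + h (j - 1) > 0"
      using min[of "j - 1"] h[OF j] h[of "j - 1"] by auto
    with False j show ?thesis
      by (simp add: heat_flux_def divide_nonpos_pos)
  qed (simp add: heat_flux_def)
  moreover have "heat_flux k h u (j + 1) \<le> 0"
  proof (cases "j + 1 = k")
    case False
    then have "u $ j \<le> u $ (j + 1)" "h (j + 1) + h j > 0"
      using j min[of "j + 1"] h[of j] h[of "j + 1"] by auto
    then show ?thesis
      by (simp add: heat_flux_def divide_nonpos_pos)
  qed (simp add: heat_flux_def)
  ultimately show ?thesis
    using j h[OF j] by (simp add: heat_rhs_def)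
qed

lemma filter_generator_heat_matrix: "filter_generator k (heat_matrix k h)"
proof -
  have "(\<Sum>l<k. heat_matrix k h $$ (j, l)) = 0" if j: "j < k" for j
  proof -
    have "(\<Sum>l<k. heat_matrix k h $$ (j, l)) = (heat_matrix k h *\<^sub>v vec k (\<lambda>_. 1)) $ j"
      using j heat_matrix_carrier[of k h] by (simp add: scalar_prod_def lessThan_atLeast0)
    also have "\<dots> = 0"
      using j by (simp add: heat_matrix_mult_vec heat_rhs_const)
    finally show ?thesis .
  qed
  then show ?thesis by (simp add: filter_generator_def heat_matrix_carrier)
qed

lemma conservative_heat_matrix:
  assumes "\<And>j. j < k \<Longrightarrow> h j \<noteq> 0"
  shows "conservative k h (heat_matrix k h)"
  unfolding conservative_def
  using heat_rhs_total_heat[OF assms] by (simp add: heat_matrix_entry)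

lemma positive_heat_matrix:
  assumes "\<And>j. j < k \<Longrightarrow> h j > 0"
  shows "positive k (heat_matrix k h)"
  unfolding positive_def
  using assms by (auto simp: heat_matrix_entry intro!: heat_rhs_nonneg_at_min)

theorem theorem2p9:
  fixes k :: nat and h :: "nat \<Rightarrow> real"
  assumes "k \<ge> 1"
    and "\<And>j. j < k \<Longrightarrow> h j > 0"
  shows "filter_generator k (heat_matrix k h) \<and> conservative k h (heat_matrix k h)
    \<and> positive k (heat_matrix k h)"
proof -
  have "h j \<noteq> 0" if "j < k" for j
    using assms(2)[OF that] by simp
  then show ?thesis
    using assms(2)
    by (simp add: filter_generator_heat_matrix conservative_heat_matrix positive_heat_matrix)
qed

end
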